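(* In the $L^2$ norm on $\mathbb{R}^2$, for every positive integer $n\leq 6$ there exists a strong crescent configuration of size $n$.
   Context: Let $\|\cdot\|$ be the $L^2$ (Euclidean) norm on $\mathbb{R}^2$. A $\|\cdot\|$ circle is a set $\{q\in\mathbb{R}^2:\|q-p\|=r\}$ with $p\in\mathbb{R}^2$, $r>0$. A set $S\subset\mathbb{R}^2$ of $n$ points is a line-like configuration of size $n$ in $\|\cdot\|$ if its distance graph is isomorphic to that of $n$ equally spaced points on a line, i.e. there is a bijection $\phi: S\to\{1,\dots,n\}$ such that for all $a,b,c,d\in S$: $\|a-b\|=\|c-d\|$ if and only if $|\phi(a)-\phi(b)|=|\phi(c)-\phi(d)|$. A set of points lies in strong general position in $\|\cdot\|$ if (1) no three of its points lie on a common line, (2) no four of its points lie on a common $\|\cdot\|$ circle, and (3) no four of its points form a line-like configuration of size four in $\|\cdot\|$. A set of $n$ points in $\mathbb{R}^2$ is a strong crescent configuration of size $n$ in $\|\cdot\|$ if (1) it lies in strong general position in $\|\cdot\|$, (2) it determines exactly $n-1$ distinct (nonzero) distances, measured in $\|\cdot\|$, and (3) for each $1\leq i\leq n-1$ there is a distance which occurs with multiplicity exactly $i$ among the unordered pairs of distinct points. *)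

theory Defs
  imports "HOL-Analysis.Analysis"
begin

text \<open>The plane is \<^typ>\<open>real^2\<close>, whose library \<^const>\<open>norm\<close> is the \<open>L\<^sup>2\<close> norm.\<close>

definition line_like :: "nat \<Rightarrow> (real^2) set \<Rightarrow> bool" where
  "line_like n S \<longleftrightarrow>
     (\<exists>\<phi> :: real^2 \<Rightarrow> int. bij_betw \<phi> S {1..int n} \<and>
        (\<forall>a\<in>S. \<forall>b\<in>S. \<forall>c\<in>S. \<forall>d\<in>S.
           norm (a - b) = norm (c - d) \<longleftrightarrow> \<bar>\<phi> a - \<phi> b\<bar> = \<bar>\<phi> c - \<phi> d\<bar>))"

definition strong_general_position :: "(real^2) set \<Rightarrow> bool" where
  "strong_general_position S \<longleftrightarrow>
     (\<forall>T. T \<subseteq> S \<and> card T = 3 \<longrightarrow> \<not> collinear T) \<and>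
     (\<forall>T. T \<subseteq> S \<and> card T = 4 \<longrightarrow> \<not> (\<exists>p r. r > 0 \<and> T \<subseteq> sphere p r)) \<and>
     (\<forall>T. T \<subseteq> S \<and> card T = 4 \<longrightarrow> \<not> line_like 4 T)"

definition distances :: "(real^2) set \<Rightarrow> real set" where
  "distances S = {norm (a - b) | a b. a \<in> S \<and> b \<in> S \<and> a \<noteq> b}"

definition multiplicity_of_distance :: "(real^2) set \<Rightarrow> real \<Rightarrow> nat" where
  "multiplicity_of_distance S d =
     card {{a, b} | a b. a \<in> S \<and> b \<in> S \<and> a \<noteq> b \<and> norm (a - b) = d}"

definition strong_crescent_configuration :: "nat \<Rightarrow> (real^2) set \<Rightarrow> bool" where
  "strong_crescent_configuration n S \<longleftrightarrow>
     finite S \<and> card S = n \<and>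
     strong_general_position S \<and>
     card (distances S) = n - 1 \<and>
     (\<forall>i\<in>{1..n - 1}. \<exists>d\<in>distances S. multiplicity_of_distance S d = i)"

end

theory Submission
  imports Defs
begin

text \<open>
  Configurations of all six sizes exist inside the triangular lattice. In coordinates with respect
  to a lattice basis the squared distance is the integral quadratic form \<open>x\<^sup>2 + x y + y\<^sup>2\<close>, and
  collinearity and concyclicity become vanishing of integer determinants, so that being a strong
  crescent configuration is a finite check on integers. The six configurations were found by a
  computer search.
\<close>

section \<open>Lattice coordinates and the norm form\<close>

definition lattice_point :: "int \<times> int \<Rightarrow> real^2" where
  "lattice_point p = vector [real_of_int (fst p) + real_of_int (snd p) / 2,
                             real_of_int (snd p) * sqrt 3 / 2]"

definition norm_form :: "int \<times> int \<Rightarrow> int" where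
  "norm_form p = fst p * fst p + fst p * snd p + snd p * snd p"

text \<open>The Euclidean determinant of two lattice vectors is \<open>sqrt 3 / 2\<close> times this
  integer, so both vanish together.\<close>

definition cross :: "int \<times> int \<Rightarrow> int \<times> int \<Rightarrow> int" where
  "cross p q = fst p * snd q - snd p * fst q"

lemma norm_lattice_point_diff:
  "norm (lattice_point p - lattice_point q) = sqrt (real_of_int (norm_form (p - q)))"
proof -
  have "sqrt 3 * sqrt 3 = (3::real)" by simp
  then show ?thesis
    by (simp add: norm_eq_sqrt_inner inner_vec_def sum_2 lattice_point_def norm_form_def
        field_simps)
qed

lemma norm_lattice_point_diff_eq_iff:
  "norm (lattice_point a - lattice_point b) = norm (lattice_point c - lattice_point d) \<longleftrightarrow>
     norm_form (a - b) = norm_form (c - d)"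
  by (simp add: norm_lattice_point_diff)

lemma inj_lattice_point: "inj lattice_point"
proof (rule injI)
  fix p q assume "lattice_point p = lattice_point q"
  then have "lattice_point p $ i = lattice_point q $ i" for i by simp
  from this[of 1] this[of 2] show "p = q"
    by (simp add: lattice_point_def prod_eq_iff)
qed

section \<open>Integer criteria for collinear, concyclic and line-like points\<close>

lemma cross_eq_0_if_collinear:
  assumes "collinear {lattice_point a, lattice_point b, lattice_point c}"
  shows "cross (b - a) (c - a) = 0"
proof -
  obtain u where u: "\<And>x y. \<lbrakk>x \<in> {lattice_point a, lattice_point b, lattice_point c};
      y \<in> {lattice_point a, lattice_point b, lattice_point c}\<rbrakk> \<Longrightarrow> \<exists>k. x - y = k *\<^sub>R u"
    using assms unfolding collinear_def by blast
  obtain k l where k: "lattice_point b - lattice_point a = k *\<^sub>R u"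
    and l: "lattice_point c - lattice_point a = l *\<^sub>R u"
    using u by blast
  \<comment> \<open>Both differences are multiples of \<open>u\<close>, so their determinant in the
    plane vanishes.\<close>
  have "(lattice_point b - lattice_point a) $ 1 * (lattice_point c - lattice_point a) $ 2
      = (lattice_point b - lattice_point a) $ 2 * (lattice_point c - lattice_point a) $ 1"
    unfolding k l by simp
  then have "sqrt 3 * real_of_int (cross (b - a) (c - a)) = 0"
    by (simp add: lattice_point_def cross_def field_simps)
  then show ?thesis by (simp only: mult_eq_0_iff of_int_eq_0_iff) simp
qed

text \<open>With \<open>a\<close> moved to the origin, the circle through \<open>a\<close> centred at \<open>w\<close> has equation
  \<open>\<parallel>x\<parallel>\<^sup>2 = 2 x \<bullet> w\<close>; so the norm form agrees on the other three points with a linear functional.\<close>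

lemma norm_form_linear_on_sphere:
  assumes a: "lattice_point a \<in> sphere p r"
  obtains u v :: real where "\<And>b. lattice_point b \<in> sphere p r \<Longrightarrow>
    real_of_int (norm_form (b - a)) = u * real_of_int (fst (b - a)) + v * real_of_int (snd (b - a))"
proof -
  define w where "w = p - lattice_point a"
  show ?thesis
  \<comment> \<open>The coefficients are \<open>2 * (w \<bullet> e)\<close> for the two lattice
    basis vectors \<open>e\<close>, with coordinates (1, 0) and (1/2,
    \<open>sqrt 3 / 2\<close>).\<close>
  proof (rule that[of "2 * w $ 1" "w $ 1 + sqrt 3 * w $ 2"])
    fix b assume b: "lattice_point b \<in> sphere p r"
    define m where "m = lattice_point b - lattice_point a"
    have "norm w = norm (m - w)"
      using a b by (simp add: w_def m_def dist_norm norm_minus_commute)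
    then have "m \<bullet> m = 2 * (m \<bullet> w)"
      by (simp add: norm_eq_sqrt_inner inner_diff inner_commute)
    moreover have "m \<bullet> m = real_of_int (norm_form (b - a))"
      using norm_lattice_point_diff[of b a] by (simp add: m_def norm_eq_sqrt_inner)
    moreover have "2 * (m \<bullet> w) = 2 * w $ 1 * real_of_int (fst (b - a))
        + (w $ 1 + sqrt 3 * w $ 2) * real_of_int (snd (b - a))"
      by (simp add: m_def inner_vec_def sum_2 lattice_point_def field_simps)
    ultimately show "real_of_int (norm_form (b - a)) = 2 * w $ 1 * real_of_int (fst (b - a))
        + (w $ 1 + sqrt 3 * w $ 2) * real_of_int (snd (b - a))"
      by simp
  qed
qed

text \<open>The 3 x 3 determinant with rows (norm form, first coordinate, second coordinate),
  expanded along its first column. It vanishes exactly when the three points and the origin lie on a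
  common circle or line.\<close>

definition circle_det :: "int \<times> int \<Rightarrow> int \<times> int \<Rightarrow> int \<times> int \<Rightarrow> int" where
  "circle_det p q r =
     norm_form p * cross q r - norm_form q * cross p r + norm_form r * cross p q"

text \<open>On a circle through \<open>a\<close> the norm form of the difference from
  \<open>a\<close> is linear in its coordinates, so the first column of the determinant is a
  combination of the other two.\<close>

lemma circle_det_eq_0_if_concyclic:
  assumes "lattice_point ` {a, b, c, d} \<subseteq> sphere p r"
  shows "circle_det (b - a) (c - a) (d - a) = 0"
proof -
  obtain u v where uv: "\<And>x. x \<in> {b, c, d} \<Longrightarrow>
      real_of_int (norm_form (x - a)) = u * real_of_int (fst (x - a)) + v * real_of_int (snd (x - a))"
    using norm_form_linear_on_sphere[of a p r] assms
    by (metis image_subset_iff insertCI)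
  have "real_of_int (circle_det (b - a) (c - a) (d - a)) = 0"
    using uv[of b] uv[of c] uv[of d]
    by (simp add: circle_det_def cross_def del: fst_diff snd_diff) (simp add: algebra_simps)
  then show ?thesis by simp
qed

text \<open>Listing the points in the order of \<open>\<phi>\<close> turns the three gaps of length
  1 and the two gaps of length 2 into equal distances. These equations can be tested on lattice
  coordinates without quantifying over \<open>\<phi>\<close>.\<close>

lemma line_like_4E:
  assumes "line_like 4 T"
  obtains a b c d where "T = {a, b, c, d}" "distinct [a, b, c, d]"
    "norm (a - b) = norm (b - c)" "norm (b - c) = norm (c - d)" "norm (a - c) = norm (b - d)"
proof -
  obtain \<phi> :: "real^2 \<Rightarrow> int" where bij: "bij_betw \<phi> T {1..4}"
    and iff: "\<And>a b c d. \<lbrakk>a \<in> T; b \<in> T; c \<in> T; d \<in> T\<rbrakk> \<Longrightarrow>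
       norm (a - b) = norm (c - d) \<longleftrightarrow> \<bar>\<phi> a - \<phi> b\<bar> = \<bar>\<phi> c - \<phi> d\<bar>"
    using assms unfolding line_like_def by auto
  define f where "f = inv_into T \<phi>"
  have range: "{1..4::int} = {1, 2, 3, 4}" by auto
  have \<phi>f: "\<phi> (f i) = i" if "i \<in> {1..4}" for i
    using bij that unfolding f_def by (simp add: bij_betw_inv_into_right)
  have T: "T = f ` {1..4}"
    using bij_betw_inv_into[OF bij] by (simp add: bij_betw_def f_def)
  show ?thesis
  proof (rule that[of "f 1" "f 2" "f 3" "f 4"])
    show "T = {f 1, f 2, f 3, f 4}" using T range by simp
    show "distinct [f 1, f 2, f 3, f 4]"
      using \<phi>f[of 1] \<phi>f[of 2] \<phi>f[of 3] \<phi>f[of 4] by auto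
  qed (use T \<phi>f in \<open>auto simp: iff\<close>)
qed

section \<open>Transfer of the integer check to the plane\<close>

text \<open>All quantifiers range over lists, so the predicate can be evaluated. The list
  \<open>pairs\<close> holds each pair in both orders, and passing to \<open>{a, b}\<close> counts
  it once; \<open>ks\<close> lists the squared distances.\<close>

definition lattice_crescent :: "nat \<Rightarrow> (int \<times> int) list \<Rightarrow> bool" where
  "lattice_crescent n ps \<longleftrightarrow>
     distinct ps \<and> length ps = n \<and>
     (\<forall>a\<in>set ps. \<forall>b\<in>set ps. \<forall>c\<in>set ps. distinct [a, b, c] \<longrightarrow> cross (b - a) (c - a) \<noteq> 0) \<and>
     (\<forall>a\<in>set ps. \<forall>b\<in>set ps. \<forall>c\<in>set ps. \<forall>d\<in>set ps. distinct [a, b, c, d] \<longrightarrow>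
        circle_det (b - a) (c - a) (d - a) \<noteq> 0 \<and>
        \<not> (norm_form (a - b) = norm_form (b - c) \<and> norm_form (b - c) = norm_form (c - d) \<and>
           norm_form (a - c) = norm_form (b - d))) \<and>
     (let pairs = filter (\<lambda>(a, b). a \<noteq> b) (List.product ps ps);
          ks = remdups (map (\<lambda>(a, b). norm_form (a - b)) pairs)
      in length ks = n - 1 \<and>
         (\<forall>i\<in>set [1..<n]. \<exists>k\<in>set ks.
            card (set (map (\<lambda>(a, b). {a, b}) (filter (\<lambda>(a, b). norm_form (a - b) = k) pairs))) = i))"

lemma strong_general_position_lattice_point:
  assumes "lattice_crescent n ps"
  shows "strong_general_position (lattice_point ` set ps)"
  unfolding strong_general_position_def
proof (intro conjI allI impI notI; elim conjE exE)
  \<comment> \<open>Injectivity pulls a subset back with its size, which yields the distinct lattice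
    coordinates that the integer check speaks of.\<close>
  have preimage: "\<exists>U \<subseteq> set ps. T = lattice_point ` U \<and> card T = card U"
    if "T \<subseteq> lattice_point ` set ps" for T
    using that inj_lattice_point by (metis card_image inj_on_subset subset_UNIV subset_imageE)
  {
    fix T assume T: "T \<subseteq> lattice_point ` set ps" "card T = 3" "collinear T"
    obtain U where U: "U \<subseteq> set ps" "T = lattice_point ` U" "card U = 3"
      using preimage[OF T(1)] T(2) by auto
    obtain a b c where abc: "U = {a, b, c}" "distinct [a, b, c]"
      using U(3) by (auto simp: card_3_iff)
    have "cross (b - a) (c - a) = 0"
      using T(3) U(2) abc(1) by (intro cross_eq_0_if_collinear) simp
    then show False
      using assms abc U(1) unfolding lattice_crescent_def by blast
  next
    fix T p and r :: real
    assume T: "T \<subseteq> lattice_point ` set ps" "card T = 4" "T \<subseteq> sphere p r"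
    obtain U where U: "U \<subseteq> set ps" "T = lattice_point ` U" "card U = 4"
      using preimage[OF T(1)] T(2) by auto
    obtain us where us: "U = set us" "distinct us" "length us = 4"
      using U(3) by (metis card_ge_0_finite distinct_card finite_distinct_list zero_less_numeral)
    obtain a b c d where "us = [a, b, c, d]"
      using us(3) by (auto simp: length_Suc_conv numeral_eq_Suc)
    with us have abcd: "U = {a, b, c, d}" "distinct [a, b, c, d]" by simp_all
    have "circle_det (b - a) (c - a) (d - a) = 0"
      using T(3) U(2) abcd(1) by (intro circle_det_eq_0_if_concyclic) simp
    then show False
      using assms abcd U(1) unfolding lattice_crescent_def by blast
  next
    fix T assume T: "T \<subseteq> lattice_point ` set ps" "line_like 4 T"
    obtain a' b' c' d' where abcd': "T = {a', b', c', d'}" "distinct [a', b', c', d']"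
      "norm (a' - b') = norm (b' - c')" "norm (b' - c') = norm (c' - d')"
      "norm (a' - c') = norm (b' - d')"
      using T(2) by (rule line_like_4E)
    obtain a b c d where abcd: "{a, b, c, d} \<subseteq> set ps"
      "a' = lattice_point a" "b' = lattice_point b" "c' = lattice_point c" "d' = lattice_point d"
      using T(1) abcd'(1) by auto
    have "distinct [a, b, c, d]"
      using abcd'(2) abcd by auto
    moreover have "norm_form (a - b) = norm_form (b - c)" "norm_form (b - c) = norm_form (c - d)"
      "norm_form (a - c) = norm_form (b - d)"
      using abcd'(3-5) unfolding abcd(2-5) norm_lattice_point_diff_eq_iff .
    ultimately show False
      using assms abcd(1) unfolding lattice_crescent_def by blast
  }
qed

text \<open>The square root is kept as the outer map so that counting distances reduces to counting
  values of \<open>norm_form\<close>.\<close>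

lemma distances_lattice_point:
  "distances (lattice_point ` P) =
     (\<lambda>k. sqrt (real_of_int k)) ` (\<lambda>(a, b). norm_form (a - b)) ` {(a, b) \<in> P \<times> P. a \<noteq> b}"
proof -
  have "distances (lattice_point ` P) =
      {sqrt (real_of_int (norm_form (a - b))) | a b. a \<in> P \<and> b \<in> P \<and> a \<noteq> b}"
    using inj_lattice_point unfolding distances_def norm_lattice_point_diff[symmetric]
    by (blast dest: injD)
  also have "\<dots> = (\<lambda>k. sqrt (real_of_int k)) ` (\<lambda>(a, b). norm_form (a - b)) `
      {(a, b) \<in> P \<times> P. a \<noteq> b}"
    unfolding image_image by force
  finally show ?thesis .
qed

text \<open>Since \<open>lattice_point\<close> is injective, so is its image map on sets; hence
  unordered pairs of coordinates and of points correspond.\<close>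

lemma multiplicity_lattice_point:
  "multiplicity_of_distance (lattice_point ` P) (sqrt (real_of_int k)) =
     card ((\<lambda>(a, b). {a, b}) ` {(a, b) \<in> P \<times> P. a \<noteq> b \<and> norm_form (a - b) = k})"
  (is "_ = card ?B")
proof -
  have "{{a, b} | a b. a \<in> lattice_point ` P \<and> b \<in> lattice_point ` P \<and> a \<noteq> b \<and>
          norm (a - b) = sqrt (real_of_int k)} = (`) lattice_point ` ?B"
    using inj_lattice_point
    by (fastforce simp: norm_lattice_point_diff inj_eq image_iff)
  moreover have "inj_on ((`) lattice_point) ?B"
    using inj_lattice_point by (simp add: inj_on_def inj_image_eq_iff)
  ultimately show ?thesis
    unfolding multiplicity_of_distance_def by (simp add: card_image)
qed

lemma strong_crescent_configuration_lattice_point: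
  assumes "lattice_crescent n ps"
  shows "strong_crescent_configuration n (lattice_point ` set ps)"
proof -
  define pairs where "pairs = filter (\<lambda>(a, b). a \<noteq> b) (List.product ps ps)"
  define ks where "ks = remdups (map (\<lambda>(a, b). norm_form (a - b)) pairs)"
  have pairs: "set pairs = {(a, b) \<in> set ps \<times> set ps. a \<noteq> b}"
    by (auto simp: pairs_def)
  have ps: "distinct ps" "length ps = n" and ks: "length ks = n - 1"
    and mult: "\<And>i. i \<in> {1..<n} \<Longrightarrow> \<exists>k\<in>set ks.
      card (set (map (\<lambda>(a, b). {a, b}) (filter (\<lambda>(a, b). norm_form (a - b) = k) pairs))) = i"
    using assms unfolding lattice_crescent_def Let_def pairs_def[symmetric] ks_def[symmetric]
    by simp_all
  have dist: "distances (lattice_point ` set ps) = (\<lambda>k. sqrt (real_of_int k)) ` set ks"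
    by (simp add: distances_lattice_point ks_def pairs)
  have "card (lattice_point ` set ps) = n"
    using ps inj_lattice_point by (metis card_image distinct_card inj_on_subset subset_UNIV)
  moreover have "card (distances (lattice_point ` set ps)) = n - 1"
  proof -
    have "card (distances (lattice_point ` set ps)) = card (set ks)"
      \<comment> \<open>In HOL \<open>sqrt\<close> is odd and injective on all reals, so no sign
        condition on \<open>ks\<close> arises.\<close>
      unfolding dist by (intro card_image) (simp add: inj_on_def)
    also have "\<dots> = length ks"
      by (rule distinct_card) (simp add: ks_def)
    finally show ?thesis using ks by simp
  qed
  moreover have "\<exists>d\<in>distances (lattice_point ` set ps).
      multiplicity_of_distance (lattice_point ` set ps) d = i" if "i \<in> {1..n - 1}" for i
  proof -
    have "i \<in> {1..<n}" using that by auto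
    then obtain k where k: "k \<in> set ks"
      "card (set (map (\<lambda>(a, b). {a, b}) (filter (\<lambda>(a, b). norm_form (a - b) = k) pairs))) = i"
      using mult by blast
    have "set (filter (\<lambda>(a, b). norm_form (a - b) = k) pairs) =
        {(a, b) \<in> set ps \<times> set ps. a \<noteq> b \<and> norm_form (a - b) = k}"
      by (auto simp: pairs)
    then have "multiplicity_of_distance (lattice_point ` set ps) (sqrt (real_of_int k)) = i"
      using k(2) by (simp only: multiplicity_lattice_point set_map)
    then show ?thesis using k(1) dist by blast
  qed
  ultimately show ?thesis
    using strong_general_position_lattice_point[OF assms]
    unfolding strong_crescent_configuration_def by simp
qed

section \<open>Explicit configurations\<close>

lemma lattice_crescent_1: "lattice_crescent 1 [(0, 0)]"
  by code_simp

lemma lattice_crescent_2: "lattice_crescent 2 [(0, 0), (0, 1)]"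
  by code_simp

lemma lattice_crescent_3: "lattice_crescent 3 [(0, 0), (0, 1), (1, 1)]"
  by code_simp

text \<open>The squared distances 12, 7, 1 occur 1, 2, 3 times.\<close>

lemma lattice_crescent_4: "lattice_crescent 4 [(0, 0), (0, 1), (1, 0), (2, 2)]"
  by code_simp

text \<open>The squared distances 4, 3, 1, 7 occur 1, 2, 3, 4 times.\<close>

lemma lattice_crescent_5: "lattice_crescent 5 [(0, 0), (0, 1), (1, 0), (1, 2), (3, -1)]"
  by code_simp

text \<open>The squared distances 7, 13, 12, 1, 19 occur 1, 2, 3, 4, 5 times.\<close>

lemma lattice_crescent_6:
  "lattice_crescent 6 [(0, 0), (0, 1), (1, 0), (2, -4), (4, -1), (5, -2)]"
  by code_simp

theorem theorem1p8:
  fixes n :: nat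
  assumes "1 \<le> n" and "n \<le> 6"
  shows "\<exists>S. strong_crescent_configuration n S"
proof -
  have "n \<in> {1, 2, 3, 4, 5, 6}" using assms by auto
  then have "\<exists>ps. lattice_crescent n ps"
    using lattice_crescent_1 lattice_crescent_2 lattice_crescent_3 lattice_crescent_4
      lattice_crescent_5 lattice_crescent_6 by blast
  then show ?thesis
    using strong_crescent_configuration_lattice_point by blast
qed

end
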